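(* Let $w\in L^1(\mathbb{R}^d)\cap L^\infty(\mathbb{R}^d)$, $w\neq0$, be a non-negative function, and let $k(x,y)=\widehat{w}(x-y)$ for $x,y\in\mathbb{R}^d$. Let $f:\mathbb{R}^d\to\mathbb{R}^d$, $f(x)=Ax+b$, with $A\in\mathcal{G}(w)$ and $b\in\mathbb{R}^d$. Then the composition operator $C_f$ is not a compact operator on $H_k$.
   Context: Fourier transform: $\widehat{h}(\xi)=\int_{\mathbb{R}^d}h(x)e^{-2\pi i x\cdot\xi}\,dx$. $H_k\subset\mathbb{C}^{\mathbb{R}^d}$ is the reproducing kernel Hilbert space of the positive definite kernel $k$: $k_x:=k(x,\cdot)\in H_k$ and $\langle h,k_x\rangle_{H_k}=h(x)$. The composition operator $C_f:H_k\to H_k$ is $C_fh=h\circ f$. $\mathcal{G}(w)$ is the set of $A\in{\rm GL}_d(\mathbb{R})$ such that for some $\lambda>0$, $w(A^\top\xi)\ge\lambda w(\xi)$ for almost every $\xi\in\mathbb{R}^d$. *)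

theory Defs
  imports "HOL-Analysis.Analysis"
begin

section \<open>Hilbert spaces of complex-valued functions\<close>

text \<open>The inner product is linear in its first argument. Only its values on \<open>H\<close> matter.\<close>

definition hnorm :: "(('a \<Rightarrow> complex) \<Rightarrow> ('a \<Rightarrow> complex) \<Rightarrow> complex) \<Rightarrow> ('a \<Rightarrow> complex) \<Rightarrow> real"
  where "hnorm ip h = sqrt (Re (ip h h))"

text \<open>The value \<open>0\<close> outside \<open>H\<close> is immaterial; it is there because the locale
  \<^locale>\<open>Metric_space\<close> asks for non-negativity and symmetry on the whole type.\<close>

definition hdist ::
  "('a \<Rightarrow> complex) set \<Rightarrow> (('a \<Rightarrow> complex) \<Rightarrow> ('a \<Rightarrow> complex) \<Rightarrow> complex)
    \<Rightarrow> ('a \<Rightarrow> complex) \<Rightarrow> ('a \<Rightarrow> complex) \<Rightarrow> real"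
  where "hdist H ip h g = (if h \<in> H \<and> g \<in> H then hnorm ip (\<lambda>x. h x - g x) else 0)"

locale function_inner_product_space =
  fixes H :: "('a \<Rightarrow> complex) set"
    and ip :: "('a \<Rightarrow> complex) \<Rightarrow> ('a \<Rightarrow> complex) \<Rightarrow> complex"
  assumes zero_mem: "(\<lambda>x. 0) \<in> H"
    and add_mem: "\<And>h g. h \<in> H \<Longrightarrow> g \<in> H \<Longrightarrow> (\<lambda>x. h x + g x) \<in> H"
    and scale_mem: "\<And>c h. h \<in> H \<Longrightarrow> (\<lambda>x. c * h x) \<in> H"
    and ip_add_left: "\<And>h g u. h \<in> H \<Longrightarrow> g \<in> H \<Longrightarrow> u \<in> H \<Longrightarrow>
          ip (\<lambda>x. h x + g x) u = ip h u + ip g u"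
    and ip_scale_left: "\<And>c h u. h \<in> H \<Longrightarrow> u \<in> H \<Longrightarrow> ip (\<lambda>x. c * h x) u = c * ip h u"
    and ip_cnj: "\<And>h g. h \<in> H \<Longrightarrow> g \<in> H \<Longrightarrow> ip g h = cnj (ip h g)"
    and ip_nonneg: "\<And>h. h \<in> H \<Longrightarrow> 0 \<le> Re (ip h h)"
    and ip_definite: "\<And>h. h \<in> H \<Longrightarrow> ip h h = 0 \<Longrightarrow> h = (\<lambda>x. 0)"
begin

lemma diff_mem: "h \<in> H \<Longrightarrow> g \<in> H \<Longrightarrow> (\<lambda>x. h x - g x) \<in> H"
  using add_mem[OF _ scale_mem[of g "-1"], of h] by simp

lemma ip_add_right:
  "h \<in> H \<Longrightarrow> g \<in> H \<Longrightarrow> u \<in> H \<Longrightarrow> ip u (\<lambda>x. h x + g x) = ip u h + ip u g"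
  using ip_cnj[of "\<lambda>x. h x + g x" u] ip_cnj[of h u] ip_cnj[of g u] add_mem[of h g]
    ip_add_left[of h g u] by simp

lemma ip_scale_right:
  "h \<in> H \<Longrightarrow> u \<in> H \<Longrightarrow> ip u (\<lambda>x. c * h x) = cnj c * ip u h"
  using ip_cnj[of "\<lambda>x. c * h x" u] ip_cnj[of h u] scale_mem[of h c] ip_scale_left[of h u c]
  by simp

lemma ip_self_real: "h \<in> H \<Longrightarrow> ip h h = of_real (Re (ip h h))"
  using ip_cnj[of h h] by (simp add: complex_eq_iff)

lemma hnorm_nonneg: "h \<in> H \<Longrightarrow> 0 \<le> hnorm ip h"
  by (simp add: hnorm_def ip_nonneg)

lemma hnorm_square: "h \<in> H \<Longrightarrow> (hnorm ip h)\<^sup>2 = Re (ip h h)"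
  by (simp add: hnorm_def ip_nonneg)

lemma hnorm_eq_0: "h \<in> H \<Longrightarrow> hnorm ip h = 0 \<longleftrightarrow> h = (\<lambda>x. 0)"
proof
  assume h: "h \<in> H" "hnorm ip h = 0"
  then have "ip h h = 0" using ip_self_real[of h] by (simp add: hnorm_def)
  then show "h = (\<lambda>x. 0)" using ip_definite h by blast
next
  assume "h \<in> H" "h = (\<lambda>x. 0)"
  then show "hnorm ip h = 0"
    using ip_scale_left[OF zero_mem zero_mem, of 0] by (simp add: hnorm_def)
qed

lemma hnorm_scale: "h \<in> H \<Longrightarrow> hnorm ip (\<lambda>x. c * h x) = cmod c * hnorm ip h"
proof -
  assume h: "h \<in> H"
  have "ip (\<lambda>x. c * h x) (\<lambda>x. c * h x) = c * cnj c * ip h h"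
    using h by (simp add: ip_scale_left ip_scale_right scale_mem)
  also have "\<dots> = of_real ((cmod c)\<^sup>2 * Re (ip h h))"
    using ip_self_real[OF h] complex_norm_square[of c] by (metis of_real_mult)
  finally show ?thesis
    by (simp add: hnorm_def real_sqrt_mult)
qed

lemma hnorm_add_square:
  assumes "h \<in> H" "g \<in> H"
  shows "(hnorm ip (\<lambda>x. h x + g x))\<^sup>2 = (hnorm ip h)\<^sup>2 + 2 * Re (ip h g) + (hnorm ip g)\<^sup>2"
proof -
  have "Re (ip g h) = Re (ip h g)"
    using ip_cnj[OF assms] by simp
  then show ?thesis
    using assms add_mem[OF assms] by (simp add: hnorm_square ip_add_left ip_add_right)
qed

lemma Re_ip_le:
  assumes "h \<in> H" "g \<in> H"
  shows "Re (ip h g) \<le> hnorm ip h * hnorm ip g"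
proof (cases "hnorm ip g = 0")
  case True
  then have "g = (\<lambda>x. 0)" using hnorm_eq_0 assms by blast
  then have "ip h g = 0"
    using ip_scale_right[OF zero_mem assms(1), of 0] by simp
  then show ?thesis using True by simp
next
  case False
  define a b where "a = hnorm ip h" and "b = hnorm ip g"
  have b: "b > 0" using False hnorm_nonneg[OF assms(2)] by (simp add: b_def)
  have a: "a \<ge> 0" using hnorm_nonneg[OF assms(1)] by (simp add: a_def)
  define t where "t = Re (ip h g) / b\<^sup>2"
  let ?u = "\<lambda>x. complex_of_real (-t) * g x"
  have "hnorm ip ?u ^ 2 = t\<^sup>2 * b\<^sup>2"
    using hnorm_scale[OF assms(2), of "of_real (-t)"] by (simp add: b_def power_mult_distrib)
  moreover have "Re (ip h ?u) = - t * Re (ip h g)"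
    using ip_scale_right[OF assms(2,1), of "of_real (-t)"] by simp
  ultimately have "0 \<le> a\<^sup>2 + 2 * (- t * Re (ip h g)) + t\<^sup>2 * b\<^sup>2"
    using hnorm_add_square[OF assms(1) scale_mem[OF assms(2)], of "of_real (-t)"]
      zero_le_power2[of "hnorm ip (\<lambda>x. h x + ?u x)"]
    by (simp add: a_def)
  also have "\<dots> = a\<^sup>2 - (Re (ip h g))\<^sup>2 / b\<^sup>2"
    using b by (simp add: t_def field_simps power2_eq_square)
  finally have "(Re (ip h g))\<^sup>2 \<le> (a * b)\<^sup>2"
    using b by (simp add: field_simps power_mult_distrib)
  then show ?thesis
    using a b power2_le_imp_le[of "Re (ip h g)" "a * b"] by (simp add: a_def b_def)
qed

lemma hnorm_triangle:
  assumes "h \<in> H" "g \<in> H"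
  shows "hnorm ip (\<lambda>x. h x + g x) \<le> hnorm ip h + hnorm ip g"
proof (rule power2_le_imp_le)
  show "(hnorm ip (\<lambda>x. h x + g x))\<^sup>2 \<le> (hnorm ip h + hnorm ip g)\<^sup>2"
    using hnorm_add_square[OF assms] Re_ip_le[OF assms] by (simp add: power2_sum)
  show "0 \<le> hnorm ip h + hnorm ip g"
    using hnorm_nonneg assms by simp
qed

lemma Metric_space_hdist: "Metric_space H (hdist H ip)"
proof
  fix h g :: "'a \<Rightarrow> complex"
  show "0 \<le> hdist H ip h g"
    by (simp add: hdist_def hnorm_nonneg diff_mem)
  show "hdist H ip h g = hdist H ip g h"
    using hnorm_scale[OF diff_mem, of h g "-1"] by (simp add: hdist_def)
next
  fix h g assume "h \<in> H" "g \<in> H"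
  then show "hdist H ip h g = 0 \<longleftrightarrow> h = g"
    by (simp add: hdist_def hnorm_eq_0 diff_mem fun_eq_iff)
next
  fix h g u assume "h \<in> H" "g \<in> H" "u \<in> H"
  then show "hdist H ip h u \<le> hdist H ip h g + hdist H ip g u"
    using hnorm_triangle[OF diff_mem diff_mem, of h g g u] by (simp add: hdist_def)
qed

sublocale Metric_space H "hdist H ip"
  by (rule Metric_space_hdist)

end

locale function_hilbert_space = function_inner_product_space +
  assumes complete: mcomplete

definition compact_operator_on ::
  "('a \<Rightarrow> complex) set \<Rightarrow> (('a \<Rightarrow> complex) \<Rightarrow> ('a \<Rightarrow> complex) \<Rightarrow> complex)
    \<Rightarrow> (('a \<Rightarrow> complex) \<Rightarrow> ('a \<Rightarrow> complex)) \<Rightarrow> bool"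
  where "compact_operator_on H ip T \<longleftrightarrow>
    T \<in> H \<rightarrow> H \<and>
    (\<forall>h\<in>H. \<forall>g\<in>H. T (\<lambda>x. h x + g x) = (\<lambda>x. T h x + T g x)) \<and>
    (\<forall>c. \<forall>h\<in>H. T (\<lambda>x. c * h x) = (\<lambda>x. c * T h x)) \<and>
    (let X = Metric_space.mtopology H (hdist H ip)
     in compactin X (X closure_of (T ` {h \<in> H. hnorm ip h \<le> 1})))"


section \<open>Reproducing kernel Hilbert spaces and composition operators\<close>

text \<open>By the Moore-Aronszajn theorem, a positive definite kernel \<open>k\<close> has exactly one such space
  (the inner product being unique on \<open>H\<close>).\<close>

locale rkhs = function_hilbert_space H ip
  for k :: "'a \<Rightarrow> 'a \<Rightarrow> complex"
    and H :: "('a \<Rightarrow> complex) set"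
    and ip :: "('a \<Rightarrow> complex) \<Rightarrow> ('a \<Rightarrow> complex) \<Rightarrow> complex" +
  assumes kernel_mem: "\<And>x. k x \<in> H"
    and reproducing: "\<And>h x. h \<in> H \<Longrightarrow> ip h (k x) = h x"

definition composition_operator :: "('a \<Rightarrow> 'a) \<Rightarrow> ('a \<Rightarrow> complex) \<Rightarrow> ('a \<Rightarrow> complex)"
  where "composition_operator f h = h \<circ> f"


section \<open>The Fourier transform and the set of admissible matrices\<close>

definition fourier_transform :: "(real ^ 'n \<Rightarrow> complex) \<Rightarrow> real ^ 'n \<Rightarrow> complex"
  where "fourier_transform h \<xi> =
    (LINT x|lebesgue. h x * exp (- 2 * of_real pi * \<i> * of_real (x \<bullet> \<xi>)))"

definition admissible_matrices :: "(real ^ 'n \<Rightarrow> real) \<Rightarrow> (real ^ 'n ^ 'n) set"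
  where "admissible_matrices w = {A. invertible A \<and>
    (\<exists>c>0. AE \<xi> in lebesgue. w (transpose A *v \<xi>) \<ge> c * w \<xi>)}"

end

theory Submission
  imports Defs
begin

text \<open>
  In the spectral picture, \<open>k x\<close> is the plane wave \<open>exp (- 2 \<pi> i \<xi> \<bullet> x)\<close> in \<open>L\<^sup>2(w)\<close>, and the adjoint of
  the composition operator should send \<open>k x\<close> to \<open>k (f x)\<close>. The condition \<open>w(A\<^sup>T \<xi>) \<ge> c w(\<xi>)\<close> and a linear
  change of variables show that this map is bounded on finite combinations of kernels
  (\<open>kernel_sum_affine_bound\<close>). Consequently, for \<open>h\<close> in \<open>H\<close>, the functional on kernel sums that should
  represent \<open>h \<circ> f\<close> is bounded, and completeness of \<open>H\<close> puts \<open>h \<circ> f\<close> into \<open>H\<close>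
  (\<open>mem_of_kernel_bound\<close>, \<open>composition_mem\<close>).

  Non-compactness comes from the translation invariance of the kernel. All kernels \<open>k a\<close> have the same
  norm \<open>\<surd>I\<close>, where \<open>I\<close> is the integral of \<open>w\<close>. As \<open>a\<close> runs through the multiples \<open>n e\<close> of a unit vector, the functions
  \<open>k a\<close> tend weakly to \<open>0\<close>, whereas \<open>k a \<circ> f\<close> takes the value \<open>I\<close> at the point that \<open>f\<close> maps to \<open>a\<close>,
  and so cannot tend to \<open>0\<close> in norm. In place of weak convergence, which would need the
  Riemann-Lebesgue lemma, the argument counts: if many of the functions \<open>k (n e) \<circ> f\<close> were close to
  each other, then the Fourier transform of \<open>w\<close> would be close to \<open>I\<close> at all differences of many integer
  multiples of \<open>e\<close> (\<open>composition_not_compact\<close>). Since \<open>w\<close> is integrable and bounded, the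
  orthogonality of integer frequencies on a cube excludes this (\<open>exists_far_frequencies\<close>).
\<close>

section \<open>Membership in a reproducing kernel Hilbert space\<close>

text \<open>Finite combinations of kernel functions are indexed by lists of coefficient-point pairs, repetitions
  allowed, so that addition is list concatenation and no question of linear independence of the
  functions \<open>k x\<close> arises.\<close>
definition kernel_sum :: "('a \<Rightarrow> 'a \<Rightarrow> complex) \<Rightarrow> (complex \<times> 'a) list \<Rightarrow> 'a \<Rightarrow> complex"
  where "kernel_sum k l = (\<lambda>y. \<Sum>(c, x)\<leftarrow>l. c * k x y)"

lemma kernel_sum_Nil: "kernel_sum k [] = (\<lambda>y. 0)"
  by (simp add: kernel_sum_def)

lemma kernel_sum_Cons: "kernel_sum k ((c, x) # l) = (\<lambda>y. c * k x y + kernel_sum k l y)"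
  by (simp add: kernel_sum_def)

lemma kernel_sum_append: "kernel_sum k (l @ m) = (\<lambda>y. kernel_sum k l y + kernel_sum k m y)"
  by (simp add: kernel_sum_def)

lemma kernel_sum_scale:
  "kernel_sum k (map (\<lambda>(c, x). (a * c, x)) l) = (\<lambda>y. a * kernel_sum k l y)"
  by (induction l) (auto simp: kernel_sum_Nil kernel_sum_Cons algebra_simps)

context rkhs
begin

lemma kernel_sum_mem: "kernel_sum k l \<in> H"
  by (induction l) (auto simp: kernel_sum_Nil kernel_sum_Cons zero_mem intro!: add_mem scale_mem kernel_mem)

lemma ip_kernel_sum:
  assumes "h \<in> H"
  shows "ip (kernel_sum k l) h = (\<Sum>(c, x)\<leftarrow>l. c * cnj (h x))"
proof (induction l)
  case Nil
  show ?case
    using ip_scale_left[OF zero_mem assms, of 0] by (simp add: kernel_sum_Nil)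
next
  case (Cons p l)
  obtain c x where p: "p = (c, x)" by fastforce
  have "ip (k x) h = cnj (h x)"
    using ip_cnj[OF assms kernel_mem] reproducing[OF assms] by simp
  then show ?case
    using Cons assms
    by (simp add: p kernel_sum_Cons ip_add_left scale_mem kernel_mem kernel_sum_mem ip_scale_left)
qed

lemma hnorm_kernel: "(hnorm ip (k x))\<^sup>2 = Re (k x x)"
  using hnorm_square[OF kernel_mem] reproducing[OF kernel_mem] by metis

lemma Re_eval_le:
  assumes "h \<in> H"
  shows "Re (h x) \<le> hnorm ip h * hnorm ip (k x)"
  using Re_ip_le[OF assms kernel_mem] reproducing[OF assms] by metis

lemma hdist_eq: "h \<in> H \<Longrightarrow> g \<in> H \<Longrightarrow> hdist H ip h g = hnorm ip (\<lambda>x. h x - g x)"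
  by (simp add: hdist_def)

text \<open>Rotating \<open>h\<close> by the phase of \<open>h x\<close> reduces the modulus to the real part.\<close>
lemma cmod_eval_le:
  assumes "h \<in> H"
  shows "cmod (h x) \<le> hnorm ip h * hnorm ip (k x)"
proof -
  define a where "a = cnj (sgn (h x))"
  have "hnorm ip (\<lambda>y. a * h y) \<le> hnorm ip h"
    using hnorm_scale[OF assms] hnorm_nonneg[OF assms]
    by (auto simp: a_def norm_sgn mult_le_cancel_right1)
  moreover have "a * h x = of_real (cmod (h x))"
    by (cases "h x = 0")
       (auto simp: a_def sgn_eq field_simps complex_norm_square[symmetric] power2_eq_square)
  moreover have "Re (a * h x) \<le> hnorm ip (\<lambda>y. a * h y) * hnorm ip (k x)"
    using Re_eval_le[OF scale_mem[OF assms]] .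
  ultimately show ?thesis
    using mult_right_mono[OF _ hnorm_nonneg[OF kernel_mem]]
    by (metis Re_complex_of_real order_trans)
qed

lemma parallelogram:
  assumes "u \<in> H" "v \<in> H"
  shows "(hnorm ip (\<lambda>x. u x - v x))\<^sup>2
    = 2 * (hnorm ip u)\<^sup>2 + 2 * (hnorm ip v)\<^sup>2 - (hnorm ip (\<lambda>x. u x + v x))\<^sup>2"
  using hnorm_add_square[OF assms] hnorm_add_square[OF assms(1) scale_mem[OF assms(2), of "-1"]]
    ip_scale_right[OF assms(2,1), of "-1"] hnorm_scale[OF assms(2), of "-1"]
  by simp

text \<open>A membership test for \<open>H\<close>, in the style of the Riesz representation theorem: \<open>g\<close> lies in \<open>H\<close> once
  the functional sending \<open>k x\<close> to \<open>cnj (g x)\<close> is bounded on the kernel sums. If it were represented by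
  \<open>u\<close>, then \<open>u\<close> would minimise the energy \<open>J v = \<parallel>v\<parallel>\<^sup>2 - 2 Re (L v)\<close>. Boundedness makes \<open>J\<close> bounded
  below, the parallelogram law makes any minimising sequence of kernel sums Cauchy, and its limit
  \<open>u\<close> (which exists by completeness) satisfies \<open>u = g\<close>, because the first variation of \<open>J\<close> at \<open>u\<close> in
  the direction \<open>k x\<close> is governed by \<open>u x - g x\<close>.\<close>
lemma mem_of_kernel_bound:
  assumes bound: "\<And>l. Re (\<Sum>(c, x)\<leftarrow>l. c * cnj (g x)) \<le> M * hnorm ip (kernel_sum k l)"
  shows "g \<in> H"
proof -
  define L where "L l = (\<Sum>(c, x)\<leftarrow>l. c * cnj (g x))" for l
  define J where "J l = (hnorm ip (kernel_sum k l))\<^sup>2 - 2 * Re (L l)" for l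
  have L_append: "L (l @ m) = L l + L m" for l m
    by (simp add: L_def)
  have L_scale: "L (map (\<lambda>(c, x). (a * c, x)) l) = a * L l" for a l
    unfolding L_def by (induction l) (auto simp: algebra_simps)
  have J_lower: "- M\<^sup>2 \<le> J l" for l
  proof -
    have "0 \<le> (hnorm ip (kernel_sum k l) - M)\<^sup>2" by simp
    then show ?thesis
      using bound[of l] by (simp add: J_def L_def power2_diff algebra_simps)
  qed
  define d where "d = Inf (range J)"
  have bdd: "bdd_below (range J)"
    using J_lower by (auto intro!: bdd_belowI)
  have d_le: "d \<le> J l" for l
    unfolding d_def using bdd by (intro cInf_lower) auto
  have "\<exists>l. J l < d + inverse (real (Suc n))" for n
    using cInf_lessD[of "range J" "d + inverse (real (Suc n))"] by (auto simp: d_def)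
  then obtain s where s: "J (s n) < d + inverse (real (Suc n))" for n
    by metis
  define v where "v n = kernel_sum k (s n)" for n
  have v_mem: "v n \<in> H" for n
    by (simp add: v_def kernel_sum_mem)
  have close: "(hdist H ip (v n) (v m))\<^sup>2 \<le> 2 * inverse (real (Suc n)) + 2 * inverse (real (Suc m))" for n m
  proof -
    let ?mid = "map (\<lambda>(c, x). (1/2 * c, x)) (s n @ s m)"
    have mid: "(hnorm ip (\<lambda>x. 1/2 * (v n x + v m x)))\<^sup>2 = (hnorm ip (\<lambda>x. v n x + v m x))\<^sup>2 / 4"
      by (subst hnorm_scale) (auto simp: add_mem v_mem power_divide)
    have "J ?mid = (hnorm ip (\<lambda>x. v n x + v m x))\<^sup>2 / 4 - Re (L (s n) + L (s m))"
      unfolding J_def kernel_sum_scale L_scale kernel_sum_append L_append mid[unfolded v_def] v_def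
      by (simp add: add_divide_distrib)
    then have "(hnorm ip (\<lambda>x. v n x - v m x))\<^sup>2 = 2 * J (s n) + 2 * J (s m) - 4 * J ?mid"
      using parallelogram[OF v_mem v_mem, of n m] by (simp add: J_def v_def)
    moreover have "d \<le> J ?mid" by (rule d_le)
    ultimately show ?thesis
      using s[of n] s[of m] by (simp add: hdist_eq v_mem)
  qed
  have "MCauchy v"
    unfolding MCauchy_def
  proof (intro conjI strip)
    show "range v \<subseteq> H" using v_mem by auto
    fix e :: real assume e: "e > 0"
    then obtain N where N: "inverse (real (Suc N)) < e\<^sup>2 / 4"
      using reals_Archimedean[of "e\<^sup>2 / 4"] by auto
    have "hdist H ip (v n) (v m) < e" if "N \<le> n" "N \<le> m" for n m
    proof (rule power2_less_imp_less)
      have "inverse (real (Suc n)) \<le> inverse (real (Suc N))" "inverse (real (Suc m)) \<le> inverse (real (Suc N))"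
        using that by (auto intro!: le_imp_inverse_le)
      then show "(hdist H ip (v n) (v m))\<^sup>2 < e\<^sup>2"
        using close[of n m] N by linarith
    qed (use e in simp)
    then show "\<exists>N. \<forall>n n'. N \<le> n \<longrightarrow> N \<le> n' \<longrightarrow> hdist H ip (v n) (v n') < e"
      by blast
  qed
  then obtain u where u: "limitin mtopology v u sequentially"
    using complete by (auto simp: mcomplete_def)
  then have u_mem: "u \<in> H" and u_lim: "(\<lambda>n. hdist H ip (v n) u) \<longlonglongrightarrow> 0"
    by (auto simp: limitin_metric_dist_null)
  have eval_lim: "(\<lambda>n. v n x) \<longlonglongrightarrow> u x" for x
  proof (rule Lim_null[THEN iffD2], rule Lim_null_comparison)
    show "\<forall>\<^sub>F n in sequentially. norm (v n x - u x) \<le> hdist H ip (v n) u * hnorm ip (k x)"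
      using cmod_eval_le[OF diff_mem[OF v_mem u_mem]] by (simp add: hdist_eq v_mem u_mem)
    show "(\<lambda>n. hdist H ip (v n) u * hnorm ip (k x)) \<longlonglongrightarrow> 0"
      using u_lim by (rule tendsto_mult_left_zero)
  qed
  have "u x = g x" for x
  proof -
    have var: "0 \<le> (cmod c * hnorm ip (k x))\<^sup>2 + 2 * Re (cnj c * (u x - g x))" for c
    proof (rule LIMSEQ_le_const)
      show "(\<lambda>n. inverse (real (Suc n)) + ((cmod c * hnorm ip (k x))\<^sup>2 + 2 * Re (cnj c * (v n x - g x))))
        \<longlonglongrightarrow> (cmod c * hnorm ip (k x))\<^sup>2 + 2 * Re (cnj c * (u x - g x))"
        by (rule tendsto_eq_intros LIMSEQ_inverse_real_of_nat eval_lim refl | simp)+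
      have "0 \<le> inverse (real (Suc n)) + ((cmod c * hnorm ip (k x))\<^sup>2 + 2 * Re (cnj c * (v n x - g x)))" for n
      proof -
        have "kernel_sum k (s n @ [(c, x)]) = (\<lambda>y. v n y + c * k x y)"
          by (simp add: kernel_sum_append kernel_sum_Cons kernel_sum_Nil v_def)
        moreover have "ip (v n) (\<lambda>y. c * k x y) = cnj c * v n x"
          using ip_scale_right[OF kernel_mem v_mem] reproducing[OF v_mem] by metis
        ultimately have "J (s n @ [(c, x)]) = J (s n) + (cmod c * hnorm ip (k x))\<^sup>2
            + 2 * Re (cnj c * v n x) - 2 * Re (c * cnj (g x))"
          using hnorm_add_square[OF v_mem scale_mem[OF kernel_mem], of n c x]
          by (simp add: J_def L_append hnorm_scale kernel_mem v_def) (simp add: L_def)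
        then show ?thesis
          using d_le[of "s n @ [(c, x)]"] s[of n] by (simp add: algebra_simps)
      qed
      then show "\<exists>N. \<forall>n\<ge>N. 0 \<le> inverse (real (Suc n)) + ((cmod c * hnorm ip (k x))\<^sup>2 + 2 * Re (cnj c * (v n x - g x)))"
        by blast
    qed
    \<comment> \<open>Descend along \<open>- t (u x - g x)\<close>; the step \<open>t = 1 / (q + 1)\<close> is small enough for the linear
      term to dominate the quadratic one, also when \<open>q = 0\<close>.\<close>
    define z where "z = u x - g x"
    define q where "q = (hnorm ip (k x))\<^sup>2"
    define t where "t = 1 / (q + 1)"
    have q: "q \<ge> 0" by (simp add: q_def)
    have "0 \<le> (cmod (- of_real t * z) * hnorm ip (k x))\<^sup>2 + 2 * Re (cnj (- of_real t * z) * z)"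
      using var[of "- of_real t * z"] by (simp add: z_def)
    moreover have "Re (cnj (- of_real t * z) * z) = - t * (cmod z)\<^sup>2"
      unfolding cmod_power2 by (simp add: power2_eq_square algebra_simps)
    moreover have "(cmod (- of_real t * z) * hnorm ip (k x))\<^sup>2 = t\<^sup>2 * (cmod z)\<^sup>2 * q"
      by (simp add: norm_mult power_mult_distrib q_def)
    ultimately have "0 \<le> t\<^sup>2 * (cmod z)\<^sup>2 * q + 2 * (- t * (cmod z)\<^sup>2)"
      by simp
    then have "0 \<le> t * (cmod z)\<^sup>2 * (t * q - 2)"
      by (simp add: algebra_simps power2_eq_square)
    moreover have "t > 0" "t * q \<le> 1"
      using q by (auto simp: t_def)
    ultimately have "(cmod z)\<^sup>2 \<le> 0"
      by (smt (verit) mult_pos_neg mult_pos_pos zero_le_power2)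
    then show ?thesis by (simp add: z_def)
  qed
  then show ?thesis
    using u_mem by (metis ext)
qed

end

section \<open>Linear changes of variables\<close>

lemma nn_integral_lborel_shift:
  fixes g :: "'a::euclidean_space \<Rightarrow> ennreal"
  assumes [measurable]: "g \<in> borel_measurable borel"
  shows "(\<integral>\<^sup>+x. g (x + t) \<partial>lborel) = (\<integral>\<^sup>+x. g x \<partial>lborel)"
proof -
  have "(\<integral>\<^sup>+x. g x \<partial>lborel) = (\<integral>\<^sup>+x. g x \<partial>distr lborel borel ((+) t))"
    by (simp add: lborel_distr_plus)
  then show ?thesis
    by (simp add: nn_integral_distr add.commute)
qed

text \<open>Uniqueness of Haar measure, specialised to the image of Lebesgue measure under \<open>T\<close>. Integrate
  \<open>g (T x)\<close> against the indicator of the unit ball in a second variable \<open>y\<close>, translate \<open>y\<close> by \<open>T x\<close>,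
  exchange the integrals and translate \<open>x\<close> by the preimage of \<open>y\<close>: the roles of \<open>g\<close> and the ball are
  interchanged, and \<open>C\<close> is the ratio of the volumes of the preimage of the ball and of the ball.\<close>
lemma nn_integral_linear_bij:
  fixes T :: "'a::euclidean_space \<Rightarrow> 'a"
  assumes T: "linear T" "bij T"
  obtains C :: real where "C \<ge> 0"
    "\<And>g. g \<in> borel_measurable borel \<Longrightarrow>
      (\<integral>\<^sup>+x. g (T x) \<partial>lborel) = ennreal C * (\<integral>\<^sup>+x. g x \<partial>lborel)"
proof -
  define V where "V = emeasure lborel (ball 0 1 :: 'a set)"
  define D where "D = emeasure lborel {x :: 'a. norm (T x) < 1}"
  have Tm [measurable]: "T \<in> borel_measurable borel"
    using T(1) by (intro borel_measurable_continuous_onI linear_continuous_on linear_conv_bounded_linear[THEN iffD1])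
  obtain S where S: "linear S" "\<And>x. S (T x) = x" "\<And>x. T (S x) = x"
    using T linear_injective_left_inverse[of T] 
    by (metis bij_def bij_is_inj inj_linear_imp_inv_linear inv_f_f surj_f_inv_f)
  have "{x. norm (T x) < 1} = S ` ball 0 1"
    by (auto simp: S intro!: image_eqI[where x = "T _"])
  moreover have "bounded (S ` ball 0 1)"
    using bounded_linear_image[OF bounded_ball] S(1) linear_conv_bounded_linear by blast
  ultimately have D: "D < \<infinity>"
    unfolding D_def by (metis emeasure_bounded_finite infinity_ennreal_def)
  have V: "V \<noteq> 0" "V < \<infinity>"
    using emeasure_bounded_finite[of "ball 0 1 :: 'a set"]
    by (auto simp: V_def emeasure_ball ennreal_eq_0_iff not_le)
  have key: "(\<integral>\<^sup>+x. g (T x) \<partial>lborel) * V = D * (\<integral>\<^sup>+x. g x \<partial>lborel)"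
    if [measurable]: "g \<in> borel_measurable borel" for g :: "'a \<Rightarrow> ennreal"
  proof -
    let ?B = "indicator (ball 0 1) :: 'a \<Rightarrow> ennreal"
    have [measurable]: "?B \<in> borel_measurable borel"
      by (intro borel_measurable_indicator borel_open open_ball)
    have "(\<integral>\<^sup>+x. g (T x) \<partial>lborel) * V = (\<integral>\<^sup>+x. \<integral>\<^sup>+y. g (T x) * ?B y \<partial>lborel \<partial>lborel)"
      by (simp add: V_def nn_integral_cmult_indicator nn_integral_multc)
    also have "\<dots> = (\<integral>\<^sup>+x. \<integral>\<^sup>+y. g (T x) * ?B (y + - T x) \<partial>lborel \<partial>lborel)"
      by (rule nn_integral_cong,
          rule nn_integral_lborel_shift[of "\<lambda>y. g (T x) * ?B y" "- T x" for x, symmetric]) measurable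
    also have "\<dots> = (\<integral>\<^sup>+y. \<integral>\<^sup>+x. g (T x) * ?B (y + - T x) \<partial>lborel \<partial>lborel)"
      by (rule lborel_pair.Fubini') measurable
    also have "\<dots> = (\<integral>\<^sup>+y. \<integral>\<^sup>+x. g (T (x + S y)) * ?B (y + - T (x + S y)) \<partial>lborel \<partial>lborel)"
      by (rule nn_integral_cong,
          rule nn_integral_lborel_shift[of "\<lambda>x. g (T x) * ?B (y + - T x)" "S y" for y, symmetric]) measurable
    \<comment> \<open>The second factor is now the indicator of the ball at \<open>- T x\<close>, and the ball is symmetric.\<close>
    also have "\<dots> = (\<integral>\<^sup>+y. \<integral>\<^sup>+x. g (y + T x) * indicator {x. norm (T x) < 1} x \<partial>lborel \<partial>lborel)"
      by (intro nn_integral_cong) (auto simp: linear_add[OF T(1)] S add.commute indicator_def)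
    also have "\<dots> = (\<integral>\<^sup>+x. \<integral>\<^sup>+y. g (y + T x) * indicator {x. norm (T x) < 1} x \<partial>lborel \<partial>lborel)"
      by (rule lborel_pair.Fubini') measurable
    also have "\<dots> = (\<integral>\<^sup>+x. (\<integral>\<^sup>+y. g y \<partial>lborel) * indicator {x. norm (T x) < 1} x \<partial>lborel)"
      by (simp add: nn_integral_multc nn_integral_lborel_shift)
    also have "\<dots> = D * (\<integral>\<^sup>+x. g x \<partial>lborel)"
      by (simp add: nn_integral_cmult D_def mult.commute)
    finally show ?thesis .
  qed
  obtain d where d: "d \<ge> 0" "D = ennreal d" using D by (cases D) auto
  obtain v where v: "v > 0" "V = ennreal v" using V by (cases V) (auto simp: less_le)
  show ?thesis
  proof (rule that[of "d / v"])
    fix g :: "'a \<Rightarrow> ennreal" assume g: "g \<in> borel_measurable borel"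
    have "ennreal (1 / v) * V = 1"
      using v by (simp add: ennreal_mult[symmetric])
    then have "(\<integral>\<^sup>+x. g (T x) \<partial>lborel) = ennreal (1 / v) * ((\<integral>\<^sup>+x. g (T x) \<partial>lborel) * V)"
      by (metis mult.left_commute mult.right_neutral)
    also have "\<dots> = ennreal (d / v) * (\<integral>\<^sup>+x. g x \<partial>lborel)"
      by (subst key[OF g]) (use v d in \<open>simp add: mult.assoc[symmetric] ennreal_mult[symmetric]\<close>)
    finally show "(\<integral>\<^sup>+x. g (T x) \<partial>lborel) = ennreal (d / v) * (\<integral>\<^sup>+x. g x \<partial>lborel)" .
  qed (use d v in auto)
qed

lemma AE_lborel_linear_bij:
  fixes T :: "'a::euclidean_space \<Rightarrow> 'a"
  assumes T: "linear T" "bij T" and P: "AE x in lborel. P x"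
  shows "AE x in lborel. P (T x)"
proof -
  have [measurable]: "T \<in> borel_measurable borel"
    using T(1) by (intro borel_measurable_continuous_onI linear_continuous_on linear_conv_bounded_linear[THEN iffD1])
  obtain N where N: "{x. \<not> P x} \<subseteq> N" "N \<in> null_sets lborel"
    using P by (auto simp: eventually_ae_filter)
  then have [measurable]: "N \<in> sets borel" by auto
  obtain C :: real where C: "\<And>g. g \<in> borel_measurable borel \<Longrightarrow>
      (\<integral>\<^sup>+x. g (T x) \<partial>lborel) = ennreal C * (\<integral>\<^sup>+x. g x \<partial>lborel)"
    using nn_integral_linear_bij[OF T] by metis
  have "(\<integral>\<^sup>+x. indicator N (T x) \<partial>lborel) = 0"
    using C[of "indicator N"] N by auto
  then have "AE x in lborel. T x \<notin> N"
    by (subst (asm) nn_integral_0_iff_AE) (auto simp: indicator_def split: if_splits)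
  then show ?thesis
    using N by (auto elim!: eventually_mono)
qed

lemma integral_linear_bij:
  fixes T :: "'a::euclidean_space \<Rightarrow> 'a"
  assumes T: "linear T" "bij T"
  obtains C :: real where "C \<ge> 0"
    "\<And>g. integrable lborel g \<Longrightarrow> (\<And>x. 0 \<le> g x) \<Longrightarrow>
      integrable lborel (\<lambda>x. g (T x)) \<and> (LINT x|lborel. g (T x)) = C * (LINT x|lborel. g x)"
proof -
  have [measurable]: "T \<in> borel_measurable borel"
    using T(1) by (intro borel_measurable_continuous_onI linear_continuous_on linear_conv_bounded_linear[THEN iffD1])
  obtain C :: real where C: "C \<ge> 0" "\<And>g. g \<in> borel_measurable borel \<Longrightarrow>
      (\<integral>\<^sup>+x. g (T x) \<partial>lborel) = ennreal C * (\<integral>\<^sup>+x. g x \<partial>lborel)"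
    using nn_integral_linear_bij[OF T] by metis
  have "integrable lborel (\<lambda>x. g (T x)) \<and> (LINT x|lborel. g (T x)) = C * (LINT x|lborel. g x)"
    if g: "integrable lborel g" "\<And>x. 0 \<le> g x" for g
  proof -
    have [measurable]: "g \<in> borel_measurable borel"
      using borel_measurable_integrable[OF g(1)] by simp
    have "(\<integral>\<^sup>+x. ennreal (g (T x)) \<partial>lborel) = ennreal (C * (LINT x|lborel. g x))"
      using C(1) C(2)[of "\<lambda>x. ennreal (g x)"] g Bochner_Integration.integral_nonneg[of lborel g]
      by (simp add: nn_integral_eq_integral ennreal_mult)
    then have "has_bochner_integral lborel (\<lambda>x. g (T x)) (C * (LINT x|lborel. g x))"
      using C g by (intro has_bochner_integral_nn_integral) auto
    then show ?thesis
      by (auto simp: has_bochner_integral_iff)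
  qed
  then show ?thesis using C that by blast
qed

section \<open>Plane waves and translation-invariant kernels\<close>

text \<open>The character by which the Fourier transform integrates: \<open>x\<close> is the frequency parameter and \<open>\<xi>\<close> the
  integration variable.\<close>
definition plane_wave :: "'a::euclidean_space \<Rightarrow> 'a \<Rightarrow> complex"
  where "plane_wave x \<xi> = cis (- (2 * pi * (\<xi> \<bullet> x)))"

definition trig_sum :: "(complex \<times> 'a::euclidean_space) list \<Rightarrow> 'a \<Rightarrow> complex"
  where "trig_sum l \<xi> = (\<Sum>(c, x)\<leftarrow>l. c * plane_wave x \<xi>)"

lemma trig_sum_simps:
  "trig_sum [] \<xi> = 0" "trig_sum ((c, x) # l) \<xi> = c * plane_wave x \<xi> + trig_sum l \<xi>"
  by (simp_all add: trig_sum_def)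

lemma norm_plane_wave: "cmod (plane_wave x \<xi>) = 1"
  by (simp add: plane_wave_def)

lemma plane_wave_add: "plane_wave (x + y) \<xi> = plane_wave x \<xi> * plane_wave y \<xi>"
  by (simp add: plane_wave_def cis_mult inner_add_right algebra_simps)

lemma plane_wave_diff: "plane_wave (x - y) \<xi> = plane_wave x \<xi> * cnj (plane_wave y \<xi>)"
  by (simp add: plane_wave_def cis_mult cis_cnj inner_diff_right algebra_simps)

lemma continuous_plane_wave: "continuous_on S (plane_wave x)"
  unfolding plane_wave_def by (intro continuous_intros)

lemma measurable_plane_wave [measurable]: "plane_wave x \<in> borel_measurable borel"
  by (intro borel_measurable_continuous_onI continuous_plane_wave)

lemma borel_measurable_cnj [measurable (raw)]:
  "F \<in> borel_measurable M \<Longrightarrow> (\<lambda>x. cnj (F x)) \<in> borel_measurable M"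
  by (rule borel_measurable_continuous_on[where f = cnj]) (intro continuous_intros)

lemma measurable_trig_sum [measurable]: "trig_sum l \<in> borel_measurable borel"
proof (induction l)
  case Nil
  then show ?case by (simp add: trig_sum_simps cong: measurable_cong)
next
  case (Cons p l)
  note Cons [measurable]
  have "trig_sum (p # l) = (\<lambda>\<xi>. fst p * plane_wave (snd p) \<xi> + trig_sum l \<xi>)"
    by (cases p) (auto simp: trig_sum_simps)
  then show ?case by simp
qed

lemma cmod_trig_sum_le: "cmod (trig_sum l \<xi>) \<le> (\<Sum>(c, x)\<leftarrow>l. cmod c)"
proof (induction l)
  case (Cons p l)
  then show ?case
    by (cases p) (auto simp: trig_sum_simps norm_mult norm_plane_wave intro!: norm_triangle_le)
qed (simp add: trig_sum_simps)

lemma integrable_mult_bounded: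
  fixes v :: "'a \<Rightarrow> real" and F :: "'a \<Rightarrow> complex"
  assumes v: "integrable M v" and F [measurable]: "F \<in> borel_measurable M" and B: "\<And>x. cmod (F x) \<le> B"
  shows "integrable M (\<lambda>x. of_real (v x) * F x)"
proof (rule Bochner_Integration.integrable_bound)
  show "integrable M (\<lambda>x. B * v x)" using v by simp
  show "(\<lambda>x. complex_of_real (v x) * F x) \<in> borel_measurable M"
    using borel_measurable_integrable[OF v] by measurable
  show "AE x in M. norm (complex_of_real (v x) * F x) \<le> norm (B * v x)"
  proof (rule AE_I2)
    fix x
    have "cmod (F x) \<le> \<bar>B\<bar>" using B[of x] by linarith
    then show "norm (complex_of_real (v x) * F x) \<le> norm (B * v x)"
      by (simp add: norm_mult abs_mult mult.commute[of "\<bar>B\<bar>"] mult_left_mono)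
  qed
qed

lemma kernel_sum_eq_integral:
  assumes v: "integrable lborel v"
    and k: "\<And>x y. k x y = (LINT \<xi>|lborel. of_real (v \<xi>) * plane_wave (x - y) \<xi>)"
  shows "kernel_sum k l y = (LINT \<xi>|lborel. of_real (v \<xi>) * (trig_sum l \<xi> * cnj (plane_wave y \<xi>)))"
proof (induction l)
  case Nil
  then show ?case by (simp add: kernel_sum_Nil trig_sum_simps)
next
  case (Cons p l)
  obtain c x where p: "p = (c, x)" by fastforce
  have 1: "integrable lborel (\<lambda>\<xi>. of_real (v \<xi>) * (plane_wave x \<xi> * cnj (plane_wave y \<xi>)))"
    by (rule integrable_mult_bounded[OF v, where B = 1]) (auto simp: norm_mult norm_plane_wave)
  have 2: "integrable lborel (\<lambda>\<xi>. of_real (v \<xi>) * (trig_sum l \<xi> * cnj (plane_wave y \<xi>)))"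
    by (rule integrable_mult_bounded[OF v]) (auto simp: norm_mult norm_plane_wave intro: cmod_trig_sum_le)
  have "(\<lambda>\<xi>. of_real (v \<xi>) * (trig_sum (p # l) \<xi> * cnj (plane_wave y \<xi>)))
      = (\<lambda>\<xi>. c * (of_real (v \<xi>) * (plane_wave x \<xi> * cnj (plane_wave y \<xi>)))
           + of_real (v \<xi>) * (trig_sum l \<xi> * cnj (plane_wave y \<xi>)))"
    by (auto simp: p trig_sum_simps algebra_simps)
  then show ?case
    using Cons 1 2 by (simp add: p kernel_sum_Cons k plane_wave_diff)
qed

text \<open>The spectral picture: \<open>k x\<close> corresponds to the plane wave at \<open>x\<close> in the weighted space \<open>L\<^sup>2(v)\<close>.
  The identity is checked on inner products of two kernels and extended by sesquilinearity.\<close>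
lemma hnorm_kernel_sum:
  fixes v :: "'a::euclidean_space \<Rightarrow> real"
  assumes rkhs: "rkhs k H ip"
    and v: "integrable lborel v"
    and k: "\<And>x y. k x y = (LINT \<xi>|lborel. of_real (v \<xi>) * plane_wave (x - y) \<xi>)"
  shows "(hnorm ip (kernel_sum k l))\<^sup>2 = (LINT \<xi>|lborel. v \<xi> * (cmod (trig_sum l \<xi>))\<^sup>2)"
proof -
  interpret rkhs k H ip by (fact rkhs)
  have "(\<Sum>(c, x)\<leftarrow>m. c * cnj (kernel_sum k l x))
      = (LINT \<xi>|lborel. of_real (v \<xi>) * (trig_sum m \<xi> * cnj (trig_sum l \<xi>)))" for m
  proof (induction m)
    case Nil
    then show ?case by (simp add: trig_sum_simps)
  next
    case (Cons p m)
    obtain c x where p: "p = (c, x)" by fastforce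
    have 1: "integrable lborel (\<lambda>\<xi>. of_real (v \<xi>) * (plane_wave x \<xi> * cnj (trig_sum l \<xi>)))"
      by (rule integrable_mult_bounded[OF v]) (auto simp: norm_mult norm_plane_wave intro: cmod_trig_sum_le)
    have 2: "integrable lborel (\<lambda>\<xi>. of_real (v \<xi>) * (trig_sum m \<xi> * cnj (trig_sum l \<xi>)))"
      by (rule integrable_mult_bounded[OF v])
         (auto simp: norm_mult intro!: mult_mono order_trans[OF norm_ge_zero] cmod_trig_sum_le)
    have "(\<lambda>\<xi>. of_real (v \<xi>) * (trig_sum (p # m) \<xi> * cnj (trig_sum l \<xi>)))
        = (\<lambda>\<xi>. c * (of_real (v \<xi>) * (plane_wave x \<xi> * cnj (trig_sum l \<xi>)))
             + of_real (v \<xi>) * (trig_sum m \<xi> * cnj (trig_sum l \<xi>)))"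
      by (auto simp: p trig_sum_simps algebra_simps)
    moreover have "cnj (kernel_sum k l x) = (LINT \<xi>|lborel. of_real (v \<xi>) * (plane_wave x \<xi> * cnj (trig_sum l \<xi>)))"
      unfolding kernel_sum_eq_integral[OF v k] Bochner_Integration.integral_cnj[symmetric] by (simp add: mult.commute)
    ultimately show ?case
      using Cons 1 2 by (simp add: p)
  qed
  from this[of l] have "ip (kernel_sum k l) (kernel_sum k l)
      = (LINT \<xi>|lborel. of_real (v \<xi> * (cmod (trig_sum l \<xi>))\<^sup>2))"
    by (simp add: ip_kernel_sum kernel_sum_mem flip: complex_norm_square)
  then show ?thesis
    by (simp add: hnorm_square kernel_sum_mem del: of_real_mult)
qed

section \<open>Boundedness of affine composition operators\<close>

text \<open>Moving all points by \<open>x \<mapsto> A x + b\<close> multiplies the trigonometric sum by a unimodular factor and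
  composes it with the transpose of \<open>A\<close>.\<close>
lemma trig_sum_affine:
  fixes A :: "real ^ 'n ^ 'n"
  shows "cmod (trig_sum (map (\<lambda>(c, x). (c, A *v x + b)) l) \<xi>) = cmod (trig_sum l (transpose A *v \<xi>))"
proof -
  have "trig_sum (map (\<lambda>(c, x). (c, A *v x + b)) l) \<xi>
      = plane_wave b \<xi> * trig_sum l (transpose A *v \<xi>)"
  proof (induction l)
    case (Cons p l)
    obtain c x where p: "p = (c, x)" by fastforce
    have "plane_wave (A *v x) \<xi> = plane_wave x (transpose A *v \<xi>)"
      by (simp add: plane_wave_def dot_lmul_matrix[symmetric] transpose_matrix_vector)
    then show ?case
      using Cons by (simp add: p trig_sum_simps plane_wave_add algebra_simps)
  qed (simp add: trig_sum_simps)
  then show ?thesis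
    by (simp add: norm_mult norm_plane_wave)
qed

lemma bij_transpose_matrix:
  fixes A :: "real ^ 'n ^ 'n"
  assumes "invertible A"
  shows "bij ((*v) (transpose A))"
  using assms by (metis invertible_eq_bij transpose_invertible)

text \<open>The would-be adjoint of the composition operator sends \<open>k x\<close> to \<open>k (A x + b)\<close>. It is bounded on
  kernel sums: in the spectral picture its square norm is the integral of
  \<open>v(\<xi>) \<bar>p(A\<^sup>T \<xi>)\<bar>\<^sup>2\<close>, the weight hypothesis replaces \<open>v(\<xi>)\<close> by \<open>v(A\<^sup>T \<xi>) / c\<close>, and a linear change of
  variables returns to the integral of \<open>v \<bar>p\<bar>\<^sup>2\<close>.\<close>
lemma kernel_sum_affine_bound:
  fixes v :: "real ^ 'n \<Rightarrow> real" and A :: "real ^ 'n ^ 'n"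
  assumes H: "rkhs k H ip"
    and v: "integrable lborel v" "\<And>\<xi>. 0 \<le> v \<xi>"
    and k: "\<And>x y. k x y = (LINT \<xi>|lborel. of_real (v \<xi>) * plane_wave (x - y) \<xi>)"
    and A: "invertible A" and c: "0 < c" "AE \<xi> in lborel. c * v \<xi> \<le> v (transpose A *v \<xi>)"
  obtains K where "\<And>l. hnorm ip (kernel_sum k (map (\<lambda>(c, x). (c, A *v x + b)) l))
    \<le> K * hnorm ip (kernel_sum k l)"
proof -
  interpret rkhs k H ip by (fact H)
  define T where "T = (*v) (transpose A)"
  have T: "linear T" "bij T"
    unfolding T_def by (rule matrix_vector_mul_linear, rule bij_transpose_matrix[OF A])
  have T_le: "AE \<xi> in lborel. c * v \<xi> \<le> v (T \<xi>)"
    using c(2) by (simp only: T_def)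
  obtain C :: real where C: "C \<ge> 0" "\<And>g. integrable lborel g \<Longrightarrow> (\<And>x. 0 \<le> g x) \<Longrightarrow>
      integrable lborel (\<lambda>x. g (T x)) \<and> (LINT x|lborel. g (T x)) = C * (LINT x|lborel. g x)"
    using integral_linear_bij[OF T] by blast
  have [measurable]: "v \<in> borel_measurable borel"
    using borel_measurable_integrable[OF v(1)] by simp
  have [measurable]: "T \<in> borel_measurable borel"
    by (intro borel_measurable_continuous_onI linear_continuous_on linear_conv_bounded_linear[THEN iffD1] T)
  show ?thesis
  proof (rule that[of "sqrt (C / c)"])
    fix l :: "(complex \<times> (real ^ 'n)) list"
    let ?fl = "map (\<lambda>(c, x). (c, A *v x + b)) l"
    let ?g = "\<lambda>\<xi>. v \<xi> * (cmod (trig_sum l \<xi>))\<^sup>2"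
    have g: "integrable lborel ?g"
    proof -
      have "integrable lborel (\<lambda>\<xi>. complex_of_real (v \<xi>) * of_real ((cmod (trig_sum l \<xi>))\<^sup>2))"
        by (rule integrable_mult_bounded[OF v(1)])
           (auto simp: norm_power intro!: power_mono cmod_trig_sum_le)
      from integrable_Re[OF this] show ?thesis
        by (simp only: of_real_mult[symmetric] Re_complex_of_real)
    qed
    have gT: "integrable lborel (\<lambda>\<xi>. ?g (T \<xi>))" "(LINT \<xi>|lborel. ?g (T \<xi>)) = C * (LINT \<xi>|lborel. ?g \<xi>)"
      using C(2)[OF g] v(2) by auto
    have "c * (hnorm ip (kernel_sum k ?fl))\<^sup>2 = (LINT \<xi>|lborel. c * (v \<xi> * (cmod (trig_sum l (T \<xi>)))\<^sup>2))"
      by (simp add: hnorm_kernel_sum[OF H v(1) k] trig_sum_affine T_def del: transpose_matrix_vector)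
    also have "\<dots> \<le> (LINT \<xi>|lborel. ?g (T \<xi>))"
    proof (rule integral_mono_AE')
      show "AE \<xi> in lborel. c * (v \<xi> * (cmod (trig_sum l (T \<xi>)))\<^sup>2) \<le> ?g (T \<xi>)"
        using T_le by eventually_elim (simp add: mult.assoc[symmetric] mult_right_mono)
    qed (use gT v c in auto)
    also have "\<dots> = C * (hnorm ip (kernel_sum k l))\<^sup>2"
      by (simp add: gT hnorm_kernel_sum[OF H v(1) k])
    finally have "(hnorm ip (kernel_sum k ?fl))\<^sup>2 \<le> C / c * (hnorm ip (kernel_sum k l))\<^sup>2"
      using c by (simp add: field_simps)
    then have "sqrt ((hnorm ip (kernel_sum k ?fl))\<^sup>2) \<le> sqrt (C / c * (hnorm ip (kernel_sum k l))\<^sup>2)"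
      by (rule real_sqrt_le_mono)
    then show "hnorm ip (kernel_sum k ?fl) \<le> sqrt (C / c) * hnorm ip (kernel_sum k l)"
      by (simp only: real_sqrt_mult real_sqrt_abs) (simp add: hnorm_nonneg kernel_sum_mem)
  qed
qed

text \<open>The functional tested for \<open>h \<circ> f\<close> is the inner product with \<open>h\<close> of the kernel sum moved by \<open>f\<close>, so the
  Cauchy-Schwarz inequality bounds it.\<close>
lemma (in rkhs) composition_mem:
  assumes K: "\<And>l. hnorm ip (kernel_sum k (map (\<lambda>(c, x). (c, f x)) l)) \<le> K * hnorm ip (kernel_sum k l)"
    and h: "h \<in> H"
  shows "h \<circ> f \<in> H"
proof (rule mem_of_kernel_bound)
  fix l :: "(complex \<times> 'a) list"
  let ?fl = "map (\<lambda>(c, x). (c, f x)) l"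
  have "(\<Sum>(c, x)\<leftarrow>l. c * cnj ((h \<circ> f) x)) = ip (kernel_sum k ?fl) h"
    by (simp add: ip_kernel_sum[OF h] case_prod_unfold comp_def)
  moreover have "Re (ip (kernel_sum k ?fl) h) \<le> K * hnorm ip (kernel_sum k l) * hnorm ip h"
    using Re_ip_le[OF kernel_sum_mem h] mult_right_mono[OF K hnorm_nonneg[OF h]] by (rule order_trans)
  ultimately show "Re (\<Sum>(c, x)\<leftarrow>l. c * cnj ((h \<circ> f) x)) \<le> (K * hnorm ip h) * hnorm ip (kernel_sum k l)"
    by (simp add: mult.commute mult.left_commute)
qed

section \<open>Separation of integer frequencies\<close>

lemma integral_lborel_prod:
  fixes f :: "'a::euclidean_space \<Rightarrow> real \<Rightarrow> real"
  assumes f: "\<And>b. b \<in> Basis \<Longrightarrow> integrable lborel (f b)"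
  shows "(LINT x|lborel. (\<Prod>b\<in>Basis. f b (x \<bullet> b))) = (\<Prod>b\<in>Basis. LINT t|lborel. f b t)"
proof -
  interpret product_sigma_finite "\<lambda>_. lborel :: real measure" ..
  have [measurable]: "f b \<in> borel_measurable borel" if "b \<in> Basis" for b
    using borel_measurable_integrable[OF f[OF that]] by simp
  have "(LINT x|lborel. (\<Prod>b\<in>Basis. f b (x \<bullet> b)))
      = (LINT y|Pi\<^sub>M Basis (\<lambda>_. lborel). (\<Prod>b\<in>Basis. f b ((\<Sum>c\<in>Basis. y c *\<^sub>R c :: 'a) \<bullet> b)))"
    by (subst lborel_eq, subst integral_distr) auto
  also have "\<dots> = (LINT y|Pi\<^sub>M Basis (\<lambda>_. lborel). (\<Prod>b\<in>Basis. f b (y b)))"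
    by simp
  also have "\<dots> = (\<Prod>b\<in>Basis. LINT t|lborel. f b t)"
    by (rule product_integral_prod) (auto intro: f)
  finally show ?thesis .
qed

abbreviation cube :: "nat \<Rightarrow> 'a::euclidean_space set"
  where "cube R \<equiv> cbox (- real R *\<^sub>R One) (real R *\<^sub>R One)"

text \<open>Orthogonality of integer frequencies on a box whose side \<open>2 R\<close> is a multiple of the period: the
  integral factors over the coordinates, and the factor in the direction \<open>e\<close> runs over full periods.\<close>
lemma integral_cube_cos:
  fixes e :: "'a::euclidean_space" and R :: nat and m :: int
  assumes e: "e \<in> Basis" and m: "m \<noteq> 0"
  shows "(LINT x|lborel. indicator (cube R) x * cos (2 * pi * of_int m * (x \<bullet> e))) = 0"
proof -
  define f where "f b t = (if b = e then cos (2 * pi * of_int m * t) else 1) * indicator {- real R..real R} t"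
    for b :: 'a and t :: real
  have int: "integrable lborel (f b)" for b
    unfolding f_def by (intro borel_integrable_atLeastAtMost, cases "b = e") (auto intro!: continuous_intros)
  have "(LINT t|lborel. f e t) =
      sin (2 * pi * of_int m * real R) / (2 * pi * of_int m) - sin (2 * pi * of_int m * - real R) / (2 * pi * of_int m)"
    unfolding f_def if_P[OF refl]
    by (rule integral_FTC_Icc_real) (use m in \<open>auto intro!: derivative_eq_intros continuous_intros\<close>)
  also have "\<dots> = 0"
    using sin_int_2pin[of "m * int R"] by (simp add: mult.assoc)
  finally have zero: "(LINT t|lborel. f e t) = 0" .
  have "(\<Prod>b\<in>Basis. f b (x \<bullet> b)) = indicator (cube R) x * cos (2 * pi * of_int m * (x \<bullet> e))" for x
  proof -
    have "(\<Prod>b\<in>Basis. indicator {- real R..real R} (x \<bullet> b)) = (indicator (cube R) x :: real)"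
      by (auto simp: indicator_def mem_box prod_zero_iff)
    then show ?thesis
      using e by (simp add: f_def prod.distrib prod.delta)
  qed
  then show ?thesis
    using integral_lborel_prod[of f] int zero e by (auto simp: prod_zero_iff)
qed

text \<open>A quantitative substitute for the Riemann-Lebesgue lemma. If all differences from \<open>C\<close> had
  transforms above half the total mass \<open>I\<close>, then \<open>D = \<bar>\<Sum>s\<in>C. exp (2 \<pi> i s \<xi>\<^sub>e)\<bar>\<^sup>2\<close> would satisfy
  \<open>\<integral> v D \<ge> K\<^sup>2 I / 2\<close>, where \<open>K\<close> is the size of \<open>C\<close>. But outside a large cube, \<open>D \<le> K\<^sup>2\<close> meets little mass of \<open>v\<close>,
  while inside it \<open>v \<le> B\<close> and orthogonality leave only the \<open>K\<close> diagonal terms. So \<open>\<integral> v D\<close>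
  is at most \<open>K\<^sup>2 I / 4 + B K V\<close>, with \<open>V\<close> the volume of the cube, which is impossible for large \<open>K\<close>.\<close>
lemma exists_far_frequencies:
  fixes v :: "'a::euclidean_space \<Rightarrow> real"
  assumes e: "e \<in> Basis"
    and v: "integrable lborel v" "\<And>\<xi>. 0 \<le> v \<xi>" "\<And>\<xi>. v \<xi> \<le> B"
    and pos: "0 < (LINT \<xi>|lborel. v \<xi>)"
  obtains N where "\<And>C :: nat set. finite C \<Longrightarrow> N \<le> card C \<Longrightarrow> \<exists>s\<in>C. \<exists>t\<in>C. s \<noteq> t \<and>
    (LINT \<xi>|lborel. v \<xi> * cos (2 * pi * of_int (int s - int t) * (\<xi> \<bullet> e))) \<le> (LINT \<xi>|lborel. v \<xi>) / 2"
proof -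
  define I where "I = (LINT \<xi>|lborel. v \<xi>)"
  have [measurable]: "v \<in> borel_measurable borel"
    using borel_measurable_integrable[OF v(1)] by simp
  have B: "B \<ge> 0" using v(2,3) order_trans by blast
  have "(\<lambda>R. LINT \<xi>|lborel. v \<xi> * indicator (cube R) \<xi>) \<longlonglongrightarrow> I"
    unfolding I_def
  proof (rule integral_dominated_convergence[where w = v])
    show "AE \<xi> in lborel. (\<lambda>R. v \<xi> * indicator (cube R) \<xi>) \<longlonglongrightarrow> v \<xi>"
    proof (rule AE_I2)
      fix \<xi> :: 'a
      obtain R0 :: nat where R0: "norm \<xi> \<le> real R0" using real_arch_simple by blast
      have "\<xi> \<in> cube R" if "R \<ge> R0" for R
      proof -
        have "\<bar>\<xi> \<bullet> b\<bar> \<le> real R" if "b \<in> Basis" for b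
          using Basis_le_norm[OF that, of \<xi>] R0 \<open>R \<ge> R0\<close> by linarith
        then show ?thesis by (auto simp: mem_box abs_le_iff minus_le_iff)
      qed
      then have "\<forall>\<^sub>F R in sequentially. v \<xi> * indicator (cube R) \<xi> = v \<xi>"
        unfolding eventually_sequentially by (intro exI[of _ R0]) simp
      then show "(\<lambda>R. v \<xi> * indicator (cube R) \<xi>) \<longlonglongrightarrow> v \<xi>"
        by (rule tendsto_eventually)
    qed
    show "AE \<xi> in lborel. norm (v \<xi> * indicator (cube R) \<xi>) \<le> v \<xi>" for R
      using v(2) by (auto simp: indicator_def)
  qed (use v in auto)
  then have "\<forall>\<^sub>F R in sequentially. (LINT \<xi>|lborel. v \<xi> * indicator (cube R) \<xi>) > 3/4 * I"
    using pos by (intro order_tendstoD(1)) (auto simp: I_def)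
  then obtain R where R: "(LINT \<xi>|lborel. v \<xi> * indicator (cube R) \<xi>) > 3/4 * I"
    by (auto simp: eventually_sequentially)
  define V where "V = measure lborel (cube R :: 'a set)"
  obtain N :: nat where N: "4 * B * V / I < real N" using reals_Archimedean2 by blast
  show ?thesis
  proof (rule that[of "Suc N"], rule ccontr)
    fix C :: "nat set"
    assume C: "finite C" "Suc N \<le> card C"
      and contra: "\<not> (\<exists>s\<in>C. \<exists>t\<in>C. s \<noteq> t \<and>
        (LINT \<xi>|lborel. v \<xi> * cos (2 * pi * of_int (int s - int t) * (\<xi> \<bullet> e))) \<le> (LINT \<xi>|lborel. v \<xi>) / 2)"
    define c where "c s t \<xi> = cos (2 * pi * of_int (int s - int t) * (\<xi> \<bullet> e))" for s t :: nat and \<xi> :: 'a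
    have [measurable]: "c s t \<in> borel_measurable borel" for s t
      unfolding c_def by measurable
    define D where "D \<xi> = (\<Sum>s\<in>C. \<Sum>t\<in>C. c s t \<xi>)" for \<xi>
    let ?K = "real (card C)"
    have D_squares: "D \<xi> = (\<Sum>s\<in>C. cos (2 * pi * real s * (\<xi> \<bullet> e)))\<^sup>2 + (\<Sum>s\<in>C. sin (2 * pi * real s * (\<xi> \<bullet> e)))\<^sup>2" for \<xi>
      by (simp add: D_def c_def power2_eq_square sum_product cos_diff algebra_simps sum.distrib)
    then have D_nonneg: "0 \<le> D \<xi>" for \<xi> by simp
    have D_le: "D \<xi> \<le> ?K\<^sup>2" for \<xi>
    proof -
      have "D \<xi> \<le> (\<Sum>s\<in>C. \<Sum>t\<in>C. 1)"
        unfolding D_def c_def by (intro sum_mono cos_le_one)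
      then show ?thesis by (simp add: power2_eq_square)
    qed
    have vc: "integrable lborel (\<lambda>\<xi>. v \<xi> * c s t \<xi>)" for s t
      by (rule Bochner_Integration.integrable_bound[OF v(1)])
         (auto simp: c_def abs_mult intro!: AE_I2 mult_left_le)
    have ic: "integrable lborel (\<lambda>\<xi>. indicator (cube R) \<xi> * c s t \<xi>)" for s t
      by (rule Bochner_Integration.integrable_bound[of _ "indicator (cube R) :: 'a \<Rightarrow> real"])
         (auto simp: c_def abs_mult indicator_def intro!: AE_I2)
    have vi: "integrable lborel (\<lambda>\<xi>. v \<xi> * indicator (cube R) \<xi>)"
      by (rule Bochner_Integration.integrable_bound[OF v(1)]) (auto simp: indicator_def intro!: AE_I2)
    have lower: "?K\<^sup>2 * (I / 2) \<le> (LINT \<xi>|lborel. v \<xi> * D \<xi>)"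
    proof -
      have "I / 2 \<le> (LINT \<xi>|lborel. v \<xi> * c s t \<xi>)" if "s \<in> C" "t \<in> C" for s t
      proof (cases "s = t")
        case False
        then have "\<not> (LINT \<xi>|lborel. v \<xi> * c s t \<xi>) \<le> I / 2"
          using contra that unfolding c_def I_def by blast
        then show ?thesis by simp
      qed (use pos in \<open>simp add: c_def I_def\<close>)
      then have "(\<Sum>s\<in>C. \<Sum>t\<in>C. I / 2) \<le> (\<Sum>s\<in>C. \<Sum>t\<in>C. LINT \<xi>|lborel. v \<xi> * c s t \<xi>)"
        by (intro sum_mono)
      also have "\<dots> = (LINT \<xi>|lborel. v \<xi> * D \<xi>)"
        using vc by (simp add: D_def sum_distrib_left)
      finally show ?thesis by (simp add: power2_eq_square algebra_simps)
    qed
    have "(LINT \<xi>|lborel. indicator (cube R) \<xi> * D \<xi>) = (\<Sum>s\<in>C. \<Sum>t\<in>C. LINT \<xi>|lborel. indicator (cube R) \<xi> * c s t \<xi>)"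
      using ic by (simp add: D_def sum_distrib_left)
    also have "\<dots> = (\<Sum>s\<in>C. \<Sum>t\<in>C. if s = t then V else 0)"
      by (intro sum.cong refl) (auto simp: V_def c_def integral_cube_cos[OF e, of "int _ - int _", simplified])
    also have "\<dots> = ?K * V" using C(1) by simp
    finally have orth: "(LINT \<xi>|lborel. indicator (cube R) \<xi> * D \<xi>) = ?K * V" .
    have "(LINT \<xi>|lborel. v \<xi> * D \<xi>)
        \<le> (LINT \<xi>|lborel. ?K\<^sup>2 * (v \<xi> - v \<xi> * indicator (cube R) \<xi>) + B * (indicator (cube R) \<xi> * D \<xi>))"
    proof (rule integral_mono)
      show "integrable lborel (\<lambda>\<xi>. v \<xi> * D \<xi>)"
        using vc by (simp add: D_def sum_distrib_left)
      show "integrable lborel (\<lambda>\<xi>. ?K\<^sup>2 * (v \<xi> - v \<xi> * indicator (cube R) \<xi>) + B * (indicator (cube R) \<xi> * D \<xi>))"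
        using v(1) vi ic by (simp add: D_def sum_distrib_left)
      fix \<xi> :: 'a
      show "v \<xi> * D \<xi> \<le> ?K\<^sup>2 * (v \<xi> - v \<xi> * indicator (cube R) \<xi>) + B * (indicator (cube R) \<xi> * D \<xi>)"
        using mult_right_mono[OF v(3) D_nonneg, of \<xi> \<xi>] mult_left_mono[OF D_le v(2), of \<xi> \<xi>]
        by (auto simp: indicator_def algebra_simps)
    qed
    also have "\<dots> = ?K\<^sup>2 * (I - (LINT \<xi>|lborel. v \<xi> * indicator (cube R) \<xi>)) + B * (?K * V)"
      using v(1) vi ic by (simp add: orth[symmetric] I_def) (simp add: D_def sum_distrib_left)
    also have "\<dots> \<le> ?K\<^sup>2 * (I / 4) + B * (?K * V)"
      using R by (intro add_right_mono mult_left_mono) auto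
    finally have "?K\<^sup>2 * (I / 4) \<le> B * (?K * V)"
      using lower by (simp add: algebra_simps)
    moreover have K: "real N < ?K" "0 < ?K" using C(2) by auto
    ultimately have "?K * (I / 4) \<le> B * V"
      by (simp add: power2_eq_square mult.assoc mult.left_commute)
    then have "?K \<le> 4 * B * V / I"
      using pos by (simp add: I_def field_simps)
    with N K show False by linarith
  qed
qed

section \<open>Non-compactness\<close>

text \<open>The normalised kernels \<open>k (a n) / \<surd>I\<close> are unit vectors. Evaluating the difference of the images of
  two of them at a point which \<open>f\<close> maps to \<open>a t\<close> gives \<open>(I - k (a s) (a t)) / \<surd>I\<close>, and evaluation has norm \<open>\<surd>I\<close>.
  So two images closer than \<open>1/2\<close> force \<open>Re (k (a s) (a t)) > I / 2\<close>. A Cauchy subsequence would yield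
  arbitrarily many indices with this property pairwise, contrary to \<open>far\<close>.\<close>
lemma (in rkhs) composition_not_compact:
  fixes a :: "nat \<Rightarrow> 'a"
  assumes diag: "\<And>x. k x x = of_real I" and I: "0 < I"
    and a: "\<And>n. a n \<in> range f"
    and far: "\<And>C :: nat set. finite C \<Longrightarrow> N \<le> card C \<Longrightarrow> \<exists>s\<in>C. \<exists>t\<in>C. s \<noteq> t \<and> Re (k (a s) (a t)) \<le> I / 2"
  shows "\<not> compact_operator_on H ip (composition_operator f)"
proof
  assume cpt: "compact_operator_on H ip (composition_operator f)"
  then have into: "composition_operator f h \<in> H" if "h \<in> H" for h
    using that by (auto simp: compact_operator_on_def)
  define S where "S = composition_operator f ` {h \<in> H. hnorm ip h \<le> 1}"
  have cptS: "compactin mtopology (mtopology closure_of S)"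
    using cpt by (simp add: compact_operator_on_def S_def Let_def)
  have norm_k: "hnorm ip (k x) = sqrt I" for x
    using hnorm_kernel[of x] hnorm_nonneg[OF kernel_mem, of x] by (simp add: diag real_sqrt_unique)
  define q where "q n = (\<lambda>y. of_real (1 / sqrt I) * k (a n) y)" for n
  have q: "q n \<in> H" "hnorm ip (q n) \<le> 1" for n
    unfolding q_def using I
    by (simp_all only: scale_mem kernel_mem hnorm_scale norm_k) (simp add: norm_divide)
  define g where "g n = composition_operator f (q n)" for n
  have gH: "g n \<in> H" for n
    using into q by (simp add: g_def)
  have "S \<subseteq> mtopology closure_of S"
    using into by (intro closure_of_subset) (auto simp: S_def)
  moreover have "g n \<in> S" for n
    using q by (auto simp: g_def S_def)
  ultimately have "range g \<subseteq> mtopology closure_of S" by blast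
  then obtain l r where r: "strict_mono r" and lim: "limitin mtopology (g \<circ> r) l sequentially"
    using cptS unfolding compactin_sequentially by blast
  have "MCauchy (g \<circ> r)"
    using lim gH by (intro convergent_imp_MCauchy) auto
  then obtain n0 where n0: "\<And>n m. n0 \<le> n \<Longrightarrow> n0 \<le> m \<Longrightarrow> hdist H ip (g (r n)) (g (r m)) < 1/2"
    unfolding MCauchy_def by (metis comp_apply half_gt_zero zero_less_one)
  define C where "C = r ` {n0..<n0 + N}"
  have "finite C" "card C = N"
    using r by (auto simp: C_def card_image strict_mono_imp_inj_on inj_on_subset)
  then obtain s t where st: "s \<in> C" "t \<in> C" "s \<noteq> t" "Re (k (a s) (a t)) \<le> I / 2"
    using far[of C] by auto
  have near: "hdist H ip (g t) (g s) < 1/2"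
    using st n0 by (auto simp: C_def)
  obtain y where y: "f y = a t" using a[of t] by (metis rangeE)
  have "Re (g t y - g s y) \<le> hdist H ip (g t) (g s) * sqrt I"
    using Re_eval_le[OF diff_mem[OF gH[of t] gH[of s]], of y] by (simp add: hdist_def gH norm_k)
  also have "\<dots> < 1/2 * sqrt I"
    using near I by (intro mult_strict_right_mono) auto
  also have "Re (g t y - g s y) = (I - Re (k (a s) (a t))) / sqrt I"
    by (simp add: g_def q_def composition_operator_def y diag diff_divide_distrib)
  finally have "I - Re (k (a s) (a t)) < I / 2"
    using I by (simp add: divide_less_eq)
  with st show False by simp
qed

section \<open>The composition operator of an admissible affine map\<close>

text \<open>Truncating a Borel representative makes the sign and the bound hold everywhere rather than almost
  everywhere. Borel measurability is what permits composition with linear maps.\<close>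
lemma fourier_transform_borel_density:
  fixes w :: "real ^ 'n \<Rightarrow> real"
  assumes "integrable lebesgue w" "\<exists>M. AE \<xi> in lebesgue. \<bar>w \<xi>\<bar> \<le> M" "AE \<xi> in lebesgue. 0 \<le> w \<xi>"
  obtains v B where "integrable lborel v" "\<And>\<xi>. 0 \<le> v \<xi>" "\<And>\<xi>. v \<xi> \<le> B"
    "AE \<xi> in lborel. w \<xi> = v \<xi>"
    "\<And>x. fourier_transform (\<lambda>\<xi>. of_real (w \<xi>)) x = (LINT \<xi>|lborel. of_real (v \<xi>) * plane_wave x \<xi>)"
proof -
  obtain B where B: "AE \<xi> in lborel. \<bar>w \<xi>\<bar> \<le> B"
    using assms(2) by (auto simp: AE_completion_iff)
  obtain u where u [measurable]: "u \<in> borel_measurable lborel" and wu: "AE \<xi> in lborel. w \<xi> = u \<xi>"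
    using completion_ex_borel_measurable_real[OF borel_measurable_integrable[OF assms(1)]] by blast
  define v where "v \<xi> = max 0 (min \<bar>B\<bar> (u \<xi>))" for \<xi>
  have [measurable]: "v \<in> borel_measurable borel"
    using u unfolding v_def by measurable
  have wv: "AE \<xi> in lborel. w \<xi> = v \<xi>"
    using wu B assms(3)[unfolded AE_completion_iff] by eventually_elim (auto simp: v_def)
  have w_m [measurable]: "w \<in> borel_measurable lebesgue"
    using assms(1) by (rule borel_measurable_integrable)
  have v_m [measurable]: "v \<in> borel_measurable lebesgue"
    by (rule measurable_completion) simp
  have "integrable lebesgue v"
    using assms(1) integrable_cong_AE[OF w_m v_m AE_completion[OF wv]] by simp
  then have v: "integrable lborel v"
    by (simp add: integrable_completion)
  have "fourier_transform (\<lambda>\<xi>. of_real (w \<xi>)) x = (LINT \<xi>|lborel. of_real (v \<xi>) * plane_wave x \<xi>)" for x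
  proof -
    have wave: "exp (- 2 * of_real pi * \<i> * of_real (\<xi> \<bullet> x)) = plane_wave x \<xi>" for \<xi>
      by (simp add: plane_wave_def cis_conv_exp algebra_simps)
    have wave_m [measurable]: "plane_wave x \<in> borel_measurable lebesgue"
      by (rule measurable_completion) simp
    have "fourier_transform (\<lambda>\<xi>. of_real (w \<xi>)) x = (LINT \<xi>|lebesgue. of_real (v \<xi>) * plane_wave x \<xi>)"
      unfolding fourier_transform_def wave
    proof (rule integral_cong_AE)
      show "AE \<xi> in lebesgue. complex_of_real (w \<xi>) * plane_wave x \<xi> = complex_of_real (v \<xi>) * plane_wave x \<xi>"
        using AE_completion[OF wv] by eventually_elim simp
    qed measurable
    then show ?thesis by (simp add: integral_completion)
  qed
  then show ?thesis
    using that[of v "\<bar>B\<bar>"] v wv by (auto simp: v_def)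
qed

theorem proposition10:
  fixes w :: "real ^ 'n \<Rightarrow> real"
    and A :: "real ^ 'n ^ 'n"
    and b :: "real ^ 'n"
    and f :: "real ^ 'n \<Rightarrow> real ^ 'n"
    and k :: "real ^ 'n \<Rightarrow> real ^ 'n \<Rightarrow> complex"
    and H :: "(real ^ 'n \<Rightarrow> complex) set"
    and ip :: "(real ^ 'n \<Rightarrow> complex) \<Rightarrow> (real ^ 'n \<Rightarrow> complex) \<Rightarrow> complex"
  assumes w_L1: "integrable lebesgue w"
    and w_Linf: "\<exists>M. AE \<xi> in lebesgue. \<bar>w \<xi>\<bar> \<le> M"
    and w_nonneg: "AE \<xi> in lebesgue. 0 \<le> w \<xi>"
    and w_nonzero: "\<not> (AE \<xi> in lebesgue. w \<xi> = 0)"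
    and k_def: "\<And>x y. k x y = fourier_transform (\<lambda>\<xi>. of_real (w \<xi>)) (x - y)"
    and H_k: "rkhs k H ip"
    and f_def: "\<And>x. f x = A *v x + b"
    and A: "A \<in> admissible_matrices w"
  shows "composition_operator f \<in> H \<rightarrow> H \<and>
         \<not> compact_operator_on H ip (composition_operator f)"
proof
  interpret rkhs k H ip by (fact H_k)
  obtain v B where v: "integrable lborel v" "\<And>\<xi>. 0 \<le> v \<xi>" "\<And>\<xi>. v \<xi> \<le> B"
    and wv: "AE \<xi> in lborel. w \<xi> = v \<xi>"
    and ft: "\<And>x. fourier_transform (\<lambda>\<xi>. of_real (w \<xi>)) x = (LINT \<xi>|lborel. of_real (v \<xi>) * plane_wave x \<xi>)"
    by (rule fourier_transform_borel_density[OF w_L1 w_Linf w_nonneg]) blast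
  have k: "k x y = (LINT \<xi>|lborel. of_real (v \<xi>) * plane_wave (x - y) \<xi>)" for x y
    by (simp add: k_def ft)
  obtain c where inv: "invertible A" and c: "0 < c" "AE \<xi> in lborel. c * w \<xi> \<le> w (transpose A *v \<xi>)"
    using A by (auto simp: admissible_matrices_def AE_completion_iff)
  have "AE \<xi> in lborel. w (transpose A *v \<xi>) = v (transpose A *v \<xi>)"
    by (rule AE_lborel_linear_bij[OF _ bij_transpose_matrix[OF inv] wv]) simp
  with c(2) wv have cv: "AE \<xi> in lborel. c * v \<xi> \<le> v (transpose A *v \<xi>)"
    by eventually_elim simp
  have f: "f = (\<lambda>x. A *v x + b)" using f_def by blast
  obtain K where K: "\<And>l. hnorm ip (kernel_sum k (map (\<lambda>(c, x). (c, f x)) l)) \<le> K * hnorm ip (kernel_sum k l)"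
    using kernel_sum_affine_bound[OF H_k v(1,2) k inv c(1) cv, of b] unfolding f by blast
  show "composition_operator f \<in> H \<rightarrow> H"
    using composition_mem[OF K] by (auto simp: composition_operator_def)

  define I where "I = (LINT \<xi>|lborel. v \<xi>)"
  have "I \<noteq> 0"
  proof
    assume "I = 0"
    then have "AE \<xi> in lborel. v \<xi> = 0"
      using integral_nonneg_eq_0_iff_AE[OF v(1)] v(2) by (simp add: I_def)
    with wv have "AE \<xi> in lborel. w \<xi> = 0" by eventually_elim simp
    then show False using w_nonzero AE_completion by blast
  qed
  then have I: "0 < I"
    using Bochner_Integration.integral_nonneg[of lborel v] v(2) by (simp add: I_def less_le)
  have diag: "k x x = of_real I" for x
    by (simp add: k I_def plane_wave_def)
  obtain e :: "real ^ 'n" where e: "e \<in> Basis" by fastforce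
  have Re_k: "Re (k (real s *\<^sub>R e) (real t *\<^sub>R e))
      = (LINT \<xi>|lborel. v \<xi> * cos (2 * pi * of_int (int s - int t) * (\<xi> \<bullet> e)))" for s t
  proof -
    have wave: "plane_wave (real s *\<^sub>R e - real t *\<^sub>R e) \<xi>
        = cis (- (2 * pi * of_int (int s - int t) * (\<xi> \<bullet> e)))" for \<xi>
      by (simp add: plane_wave_def inner_diff_right algebra_simps)
    have "integrable lborel (\<lambda>\<xi>. of_real (v \<xi>) * plane_wave (real s *\<^sub>R e - real t *\<^sub>R e) \<xi>)"
      by (rule integrable_mult_bounded[OF v(1), where B = 1]) (auto simp: norm_plane_wave)
    then show ?thesis
      unfolding k by (subst integral_Re[symmetric]) (simp_all add: wave)
  qed
  obtain N where N: "\<And>C :: nat set. finite C \<Longrightarrow> N \<le> card C \<Longrightarrow> \<exists>s\<in>C. \<exists>t\<in>C. s \<noteq> t \<and>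
      (LINT \<xi>|lborel. v \<xi> * cos (2 * pi * of_int (int s - int t) * (\<xi> \<bullet> e))) \<le> (LINT \<xi>|lborel. v \<xi>) / 2"
    by (rule exists_far_frequencies[OF e v I[unfolded I_def]]) blast
  have "x \<in> range f" for x
  proof -
    obtain y where "A *v y = x - b"
      using inv by (metis invertible_eq_bij bij_pointE)
    then show ?thesis by (intro image_eqI[of _ _ y]) (auto simp: f)
  qed
  then show "\<not> compact_operator_on H ip (composition_operator f)"
    using N by (intro composition_not_compact[of I "\<lambda>n. real n *\<^sub>R e" f N] diag I)
      (auto simp: Re_k I_def)
qed

end
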